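(* Consider the smooth problem $\min_{y,z} f(y,z)$ subject to $\sum_{i=1}^b y_i=0$, let $x^0$ be a feasible initial point, and let $\{x^k\}_{k\ge 0}$ be the sequence generated by the randomized pairwise coordinate descent method (described in the context) with $\alpha_k=1$ for all $k\ge 0$. Let $f^*$ denote the optimal value. Then for every $k\ge 1$, $$\mathbb{E}[f(x^k)]-f^*\le \frac{2R^2(x^0)}{k},$$ where $$R(x^0)=\max_{x:\,f(x)\le f(x^0)}\ \max_{x^*\in X^*}\ \|x-x^*\|_{\mathcal K}^*.$$
   Context: Problem. Variables are $y=(y_1,\dots,y_b)$, $z=(z_1,\dots,z_b)$ with $y_i\in\mathbb{R}^{n_y}$, $z_i\in\mathbb{R}^{n_z}$; write $x=(y,z)$, and let block $i$ be $x_i=(y_i,z_i)$. The function $f$ is convex and continuously differentiable. The problem is to minimize $f(y,z)$ subject to $\sum_{i=1}^b y_i=0$; $X^*$ denotes its (nonempty) set of optimal solutions and $f^*$ its optimal value. Block partial gradients are Lipschitz with a common constant $L>0$: for each $i$, $\|\nabla_i f(x+U_i h)-\nabla_i f(x)\|\le L\|h\|$ for all $x,h$, where $U_i$ embeds a block-$i$ vector into the full space; likewise, for each edge $(i,j)$, the partial gradient $\nabla_{ij}f$ with respect to $(x_i,x_j)$ is $L$-Lipschitz with respect to changes in the blocks $(x_i,x_j)$. Communication graph. $G=(V,E)$ is a connected graph on $V=\{1,\dots,b\}$; edge $(i,j)\in E$ is chosen with probability $p_{ij}=p_{ji}>0$, probabilities summing to $1$ over the (unordered) edges, and $p_{ij}=0$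 for non-edges. Put $p_i=\sum_{j\ne i}p_{ij}$. Algorithm. Start from a feasible $x^0$. At iteration $k\ge0$ draw an edge $(i_k,j_k)\in E$ independently of the past with probability $p_{i_kj_k}$, let $d_{i_kj_k}=(d_{i_k},d_{j_k})$ be the minimizer of $$f(x^k)+\langle\nabla_{i_kj_k}f(x^k),d_{i_kj_k}\rangle+\frac{L}{2\alpha_k}\|d_{i_kj_k}\|^2$$ over all $d_{i_kj_k}$ whose $y$-parts satisfy $d_{y_{i_k}}+d_{y_{j_k}}=0$, and set $x^{k+1}$ to be $x^k$ with blocks $i_k,j_k$ incremented by $d_{i_k},d_{j_k}$. Equivalently, $d_{y_{i_k}}=-d_{y_{j_k}}=\frac{\alpha_k}{2L}(\nabla_{y_{j_k}}f(x^k)-\nabla_{y_{i_k}}f(x^k))$, $d_{z_{i_k}}=-\frac{\alpha_k}{L}\nabla_{z_{i_k}}f(x^k)$, $d_{z_{j_k}}=-\frac{\alpha_k}{L}\nabla_{z_{j_k}}f(x^k)$. The expectation is over the random edges. Norms. Let $\mathcal L,\mathcal D\in\mathbb{R}^{b\times b}$ be given by $\mathcal L_{ii}=\sum_{r\ne i}\frac{p_{ir}}{2L}$, $\mathcal L_{ij}=-\frac{p_{ij}}{2L}$ for $i\ne j$, $\mathcal D=\mathrm{diag}(p_1/L,\dots,p_b/L)$. Let $\mathcal K$ be the block diagonal matrix with blocks $\mathcal L\otimes I_{n_y}$ (acting on $y$) and $\mathcal D\otimes I_{n_z}$ (acting on $z$), $\|x\|_{\mathcal K}=\sqrt{x^\top\mathcal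 K x}$, and $$\|x\|_{\mathcal K}^*=\sqrt{y^\top(\mathcal L^+\otimes I_{n_y})y+z^\top(\mathcal D^{-1}\otimes I_{n_z})z},$$ where $\mathcal L^+$ is the Moore–Penrose pseudoinverse. The maxima defining $R(x^0)$ are assumed to exist. *)

theory Defs
  imports "HOL-Probability.Probability"
begin

text \<open>
  The blocks are indexed by the finite type \<open>'b\<close>, so that \<open>b = CARD('b)\<close>; likewise
  \<open>n\<^sub>y = CARD('y)\<close> and \<open>n\<^sub>z = CARD('z)\<close>. Norms and inner products on the product types below
  are the Euclidean ones.
\<close>

type_synonym ('y, 'z) block = "(real ^ 'y) \<times> (real ^ 'z)"
type_synonym ('b, 'y, 'z) point = "((real ^ 'y) ^ 'b) \<times> ((real ^ 'z) ^ 'b)"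

definition block :: "'b \<Rightarrow> ('b::finite, 'y::finite, 'z::finite) point \<Rightarrow> ('y, 'z) block" where
  "block i x = (fst x $ i, snd x $ i)"

definition block_pair ::
  "'b \<Rightarrow> 'b \<Rightarrow> ('b::finite, 'y::finite, 'z::finite) point \<Rightarrow> ('y, 'z) block \<times> ('y, 'z) block" where
  "block_pair i j x = (block i x, block j x)"

definition embed :: "'b \<Rightarrow> ('y::finite, 'z::finite) block \<Rightarrow> ('b::finite, 'y, 'z) point" where
  "embed i h = (axis i (fst h), axis i (snd h))"

definition embed_pair ::
  "'b \<Rightarrow> 'b \<Rightarrow> ('y::finite, 'z::finite) block \<times> ('y, 'z) block \<Rightarrow> ('b::finite, 'y, 'z) point" where
  "embed_pair i j d = embed i (fst d) + embed j (snd d)"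

definition feasible :: "('b::finite, 'y::finite, 'z::finite) point \<Rightarrow> bool" where
  "feasible x \<longleftrightarrow> (\<Sum>i\<in>UNIV. fst x $ i) = 0"

definition optimal_set ::
  "(('b::finite, 'y::finite, 'z::finite) point \<Rightarrow> real) \<Rightarrow> ('b, 'y, 'z) point set" where
  "optimal_set f = {x. is_arg_min f feasible x}"

definition optimal_value ::
  "(('b::finite, 'y::finite, 'z::finite) point \<Rightarrow> real) \<Rightarrow> real" where
  "optimal_value f = (INF x\<in>{x. feasible x}. f x)"

text \<open>
  Below, \<open>gf\<close> is the full gradient of \<open>f\<close>; the partial gradients with respect to one or two
  blocks are its components \<open>block i (gf x)\<close> and \<open>block_pair i j (gf x)\<close>.
\<close>

definition block_lipschitz ::
  "real \<Rightarrow> (('b::finite, 'y::finite, 'z::finite) point \<Rightarrow> ('b, 'y, 'z) point) \<Rightarrow> bool" where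
  "block_lipschitz L gf \<longleftrightarrow>
     (\<forall>i x h. norm (block i (gf (x + embed i h)) - block i (gf x)) \<le> L * norm h)"

definition edge_lipschitz ::
  "real \<Rightarrow> 'b set set \<Rightarrow> (('b::finite, 'y::finite, 'z::finite) point \<Rightarrow> ('b, 'y, 'z) point) \<Rightarrow> bool" where
  "edge_lipschitz L E gf \<longleftrightarrow>
     (\<forall>i j x h. {i, j} \<in> E \<longrightarrow>
        norm (block_pair i j (gf (x + embed_pair i j h)) - block_pair i j (gf x)) \<le> L * norm h)"

text \<open>
  Edges are two-element sets of vertices, and the probability of the edge \<open>(i, j)\<close> is
  \<open>p {i, j}\<close>; the symmetry of the probabilities is thereby built in.
\<close>

definition connected_graph :: "'b set set \<Rightarrow> bool" where
  "connected_graph E \<longleftrightarrow>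
     (\<forall>e\<in>E. \<exists>i j. i \<noteq> j \<and> e = {i, j}) \<and>
     (\<forall>i j. (i, j) \<in> {(u, v). {u, v} \<in> E}\<^sup>*)"

definition edge_probabilities :: "('b::finite) set set \<Rightarrow> ('b set \<Rightarrow> real) \<Rightarrow> bool" where
  "edge_probabilities E p \<longleftrightarrow>
     (\<forall>e\<in>E. 0 < p e) \<and> (\<forall>e. e \<notin> E \<longrightarrow> p e = 0) \<and> (\<Sum>e\<in>E. p e) = 1"

definition pair_model ::
  "(('b::finite, 'y::finite, 'z::finite) point \<Rightarrow> real) \<Rightarrow> (('b, 'y, 'z) point \<Rightarrow> ('b, 'y, 'z) point) \<Rightarrow>
     real \<Rightarrow> real \<Rightarrow> 'b \<Rightarrow> 'b \<Rightarrow> ('b, 'y, 'z) point \<Rightarrow> ('y, 'z) block \<times> ('y, 'z) block \<Rightarrow> real" where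
  "pair_model f gf L \<alpha> i j x d =
     f x + block_pair i j (gf x) \<bullet> d + L / (2 * \<alpha>) * (norm d)\<^sup>2"

definition pair_feasible :: "('y::finite, 'z::finite) block \<times> ('y, 'z) block \<Rightarrow> bool" where
  "pair_feasible d \<longleftrightarrow> fst (fst d) + fst (snd d) = 0"

text \<open>The step does not depend on which endpoint of the edge \<open>e\<close> is named \<open>i\<close>.\<close>

definition descent_step ::
  "(('b::finite, 'y::finite, 'z::finite) point \<Rightarrow> real) \<Rightarrow> (('b, 'y, 'z) point \<Rightarrow> ('b, 'y, 'z) point) \<Rightarrow>
     real \<Rightarrow> real \<Rightarrow> 'b set \<Rightarrow> ('b, 'y, 'z) point \<Rightarrow> ('b, 'y, 'z) point \<Rightarrow> bool" where
  "descent_step f gf L \<alpha> e x x' \<longleftrightarrow>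
     (\<exists>i j d. i \<noteq> j \<and> e = {i, j} \<and>
        is_arg_min (pair_model f gf L \<alpha> i j x) pair_feasible d \<and>
        x' = x + embed_pair i j d)"

definition descent_run ::
  "(('b::finite, 'y::finite, 'z::finite) point \<Rightarrow> real) \<Rightarrow> (('b, 'y, 'z) point \<Rightarrow> ('b, 'y, 'z) point) \<Rightarrow>
     real \<Rightarrow> (nat \<Rightarrow> real) \<Rightarrow> ('b, 'y, 'z) point \<Rightarrow> (nat \<Rightarrow> 'b set) \<Rightarrow> (nat \<Rightarrow> ('b, 'y, 'z) point) \<Rightarrow> bool" where
  "descent_run f gf L \<alpha> x0 e x \<longleftrightarrow>
     x 0 = x0 \<and> (\<forall>k. descent_step f gf L (\<alpha> k) (e k) (x k) (x (Suc k)))"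

definition laplacian :: "real \<Rightarrow> ('b::finite set \<Rightarrow> real) \<Rightarrow> real ^ 'b ^ 'b" where
  "laplacian L p =
     (\<chi> i j. if i = j then (\<Sum>r\<in>UNIV - {i}. p {i, r} / (2 * L)) else - (p {i, j} / (2 * L)))"

definition degree_matrix :: "real \<Rightarrow> ('b::finite set \<Rightarrow> real) \<Rightarrow> real ^ 'b ^ 'b" where
  "degree_matrix L p = (\<chi> i j. if i = j then (\<Sum>r\<in>UNIV - {i}. p {i, r}) / L else 0)"

text \<open>The four Penrose equations have exactly one solution.\<close>

definition pseudoinverse :: "real ^ 'n ^ 'm \<Rightarrow> real ^ 'm ^ 'n" where
  "pseudoinverse A =
     (THE P. A ** P ** A = A \<and> P ** A ** P = P \<and>
             transpose (A ** P) = A ** P \<and> transpose (P ** A) = P ** A)"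

definition kronecker ::
  "real ^ 'n ^ 'm \<Rightarrow> real ^ 'l ^ 'k \<Rightarrow> real ^ ('n::finite \<times> 'l::finite) ^ ('m::finite \<times> 'k::finite)" where
  "kronecker A B = (\<chi> r c. A $ fst r $ fst c * B $ snd r $ snd c)"

definition stack :: "(real ^ 'n) ^ 'b \<Rightarrow> real ^ ('b::finite \<times> 'n::finite)" where
  "stack v = (\<chi> r. v $ fst r $ snd r)"

definition dual_norm :: "real \<Rightarrow> ('b set \<Rightarrow> real) \<Rightarrow> ('b::finite, 'y::finite, 'z::finite) point \<Rightarrow> real" where
  "dual_norm L p x =
     sqrt (stack (fst x) \<bullet> (kronecker (pseudoinverse (laplacian L p)) (mat 1) *v stack (fst x)) +
           stack (snd x) \<bullet> (kronecker (matrix_inv (degree_matrix L p)) (mat 1) *v stack (snd x)))"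

definition attains_max :: "('a \<Rightarrow> real) \<Rightarrow> 'a set \<Rightarrow> bool" where
  "attains_max g S \<longleftrightarrow> (\<exists>x\<in>S. \<forall>y\<in>S. g y \<le> g x)"

definition farthest_optimum ::
  "(('b::finite, 'y::finite, 'z::finite) point \<Rightarrow> real) \<Rightarrow> real \<Rightarrow> ('b set \<Rightarrow> real) \<Rightarrow> ('b, 'y, 'z) point \<Rightarrow> real" where
  "farthest_optimum f L p x = (SUP xs\<in>optimal_set f. dual_norm L p (x - xs))"

definition radius ::
  "(('b::finite, 'y::finite, 'z::finite) point \<Rightarrow> real) \<Rightarrow> real \<Rightarrow> ('b set \<Rightarrow> real) \<Rightarrow> ('b, 'y, 'z) point \<Rightarrow> real" where
  "radius f L p x0 = (SUP x\<in>{x. f x \<le> f x0}. farthest_optimum f L p x)"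

text \<open>Existence of the two nested maxima; under it the suprema above are maxima.\<close>

definition radius_exists ::
  "(('b::finite, 'y::finite, 'z::finite) point \<Rightarrow> real) \<Rightarrow> real \<Rightarrow> ('b set \<Rightarrow> real) \<Rightarrow> ('b, 'y, 'z) point \<Rightarrow> bool" where
  "radius_exists f L p x0 \<longleftrightarrow>
     (\<forall>x. f x \<le> f x0 \<longrightarrow> attains_max (\<lambda>xs. dual_norm L p (x - xs)) (optimal_set f)) \<and>
     attains_max (farthest_optimum f L p) {x. f x \<le> f x0}"

end

theory Submission
  imports Defs
begin

text \<open>
  Write \<open>g\<close> for the gradient at the current iterate. Minimizing the quadratic upper model over an edge
  decreases \<open>f\<close> by half of the contribution of that edge to \<open>\<parallel>g\<parallel>\<^sub>K\<^sup>2\<close>, so the expected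
  decrease of one step is at least \<open>\<parallel>g\<parallel>\<^sub>K\<^sup>2 / 2\<close>. Convexity and the Cauchy-Schwarz inequality for the
  semidefinite form \<open>K\<close> bound the gap \<open>f x - f\<^sup>*\<close> by \<open>\<parallel>g\<parallel>\<^sub>K R\<close>: differences of feasible points lie
  in the range of \<open>K\<close>, because the Laplacian of a connected graph vanishes only on constant vectors.
  With Jensen's inequality, the expected gaps satisfy
  \<open>\<Delta>\<^sub>k\<^sup>2 \<le> 2 R\<^sup>2 (\<Delta>\<^sub>k - \<Delta>\<^bsub>k+1\<^esub>)\<close>, whence \<open>k \<Delta>\<^sub>k \<le> 2 R\<^sup>2\<close>.
\<close>

section \<open>Matrices acting on vectors of blocks\<close>

text \<open>The action of \<open>A\<close> Kronecker identity, without flattening indices; entries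
  may lie in any real vector space, so one definition serves the \<open>y\<close> blocks, the
  \<open>z\<close> blocks and plain real vectors.\<close>

definition block_mult :: "real ^ 'n ^ 'm \<Rightarrow> 'v::real_vector ^ 'n \<Rightarrow> 'v ^ 'm" where
  "block_mult A v = (\<chi> i. \<Sum>j\<in>UNIV. A $ i $ j *\<^sub>R v $ j)"

lemma block_mult_matrix_mul:
  "block_mult (A ** B) v = block_mult A (block_mult B v)"
  unfolding block_mult_def matrix_matrix_mult_def vec_eq_iff
  by (auto simp: scaleR_sum_left scaleR_sum_right intro: sum.swap)

lemma block_mult_mat_1 [simp]: "block_mult (mat 1) v = v"
  by (simp add: block_mult_def mat_def vec_eq_iff if_distrib[of "\<lambda>c. c *\<^sub>R _"] cong: if_cong)

lemma inner_kronecker_mat_1: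
  fixes A :: "real ^ 'n ^ 'm" and v :: "(real ^ 'l) ^ 'n"
  shows "stack u \<bullet> (kronecker A (mat 1) *v stack v) = u \<bullet> block_mult A v"
proof -
  have "stack u \<bullet> (kronecker A (mat 1) *v stack v) =
      (\<Sum>i\<in>UNIV. \<Sum>c\<in>UNIV. u $ i $ c *
        (\<Sum>j\<in>UNIV. \<Sum>d\<in>UNIV. A $ i $ j * (if c = d then 1 else 0) * v $ j $ d))"
    by (simp add: stack_def kronecker_def matrix_vector_mult_def mat_def inner_vec_def
        sum.cartesian_product case_prod_unfold)
  also have "\<dots> = (\<Sum>i\<in>UNIV. \<Sum>c\<in>UNIV. u $ i $ c * (\<Sum>j\<in>UNIV. A $ i $ j * v $ j $ c))"
    by (simp add: if_distrib[of "\<lambda>t. _ * t"] if_distrib[of "\<lambda>t. t * _"] cong: if_cong)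
  also have "\<dots> = u \<bullet> block_mult A v"
    by (simp add: block_mult_def inner_vec_def)
  finally show ?thesis .
qed

lemma block_mult_real_eq: "block_mult A (v :: real ^ 'n) = A *v v"
  by (simp add: block_mult_def matrix_vector_mult_def)

section \<open>The Moore-Penrose pseudoinverse\<close>

lemma matrix_mult_distribs:
  fixes A B C :: "real ^ 'n ^ 'n"
  shows "(A + B) ** C = A ** C + B ** C"
    and "(A - B) ** C = A ** C - B ** C"
    and "A ** (B - C) = A ** B - A ** C"
  by (simp_all add: matrix_matrix_mult_def vec_eq_iff algebra_simps sum.distrib sum_subtractf)

definition penrose :: "real ^ 'n ^ 'm \<Rightarrow> real ^ 'm ^ 'n \<Rightarrow> bool" where
  "penrose A P \<longleftrightarrow> A ** P ** A = A \<and> P ** A ** P = P \<and>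
     transpose (A ** P) = A ** P \<and> transpose (P ** A) = P ** A"

text \<open>\<open>A ** P\<close> and \<open>A ** Q\<close> are symmetric and absorb each other, so
  transposing their product identifies them; \<open>P ** A\<close> and \<open>Q ** A\<close> agree
  likewise. Then \<open>P = P ** A ** P\<close> turns into \<open>Q ** A ** Q = Q\<close>.\<close>

lemma penrose_unique:
  assumes P: "penrose A P" and Q: "penrose A Q"
  shows "P = Q"
proof -
  note P = P[unfolded penrose_def] and Q = Q[unfolded penrose_def]
  have "A ** P = (A ** Q) ** (A ** P)"
    using Q by (simp add: matrix_mul_assoc)
  also have "\<dots> = transpose (A ** P ** (A ** Q))"
    using P Q by (simp add: matrix_transpose_mul[of "A ** P"])
  also have "\<dots> = A ** Q"
    using P Q by (simp add: matrix_mul_assoc)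
  finally have AP: "A ** P = A ** Q" .
  have "P ** A = (P ** A) ** (Q ** A)"
    using Q by (simp add: matrix_mul_assoc[symmetric])
  also have "\<dots> = transpose (Q ** A ** (P ** A))"
    using P Q by (simp add: matrix_transpose_mul[of "Q ** A"])
  also have "\<dots> = Q ** A"
    using P Q by (simp add: matrix_mul_assoc[symmetric])
  finally have PA: "P ** A = Q ** A" .
  have "P = P ** (A ** P)"
    using P by (simp add: matrix_mul_assoc)
  also have "\<dots> = Q ** A ** Q"
    by (simp add: AP PA matrix_mul_assoc)
  finally show ?thesis
    using Q by simp
qed

lemma pseudoinverse_eqI: "penrose A P \<Longrightarrow> pseudoinverse A = P"
  unfolding pseudoinverse_def penrose_def[symmetric]
  by (rule the_equality) (auto intro: penrose_unique)

text \<open>For \<open>A\<close> symmetric, \<open>N\<close> is to be the orthogonal projection onto the kernel of \<open>A\<close>.\<close>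

lemma pseudoinverse_regularized:
  fixes A N :: "real ^ 'n ^ 'n"
  assumes "A ** N = 0" "N ** A = 0" "N ** N = N" "transpose N = N" "invertible (A + N)"
  shows "A ** pseudoinverse A = mat 1 - N"
proof -
  obtain S where S: "(A + N) ** S = mat 1" "S ** (A + N) = mat 1"
    using assms(5) by (auto simp: invertible_def)
  have SN: "S ** N = N"
  proof -
    have "S ** N = S ** ((A + N) ** N)"
      using assms by (simp add: matrix_mult_distribs)
    then show ?thesis by (simp add: matrix_mul_assoc S)
  qed
  have NS: "N ** S = N"
  proof -
    have "N ** S = N ** (A + N) ** S"
      using assms by (simp add: matrix_add_ldistrib)
    then show ?thesis by (simp add: matrix_mul_assoc[symmetric] S)
  qed
  \<comment> \<open>\<open>S\<close> inverts \<open>A\<close> off the kernel and is the identity on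
    it; subtracting \<open>N\<close> makes the kernel part zero, as in a pseudoinverse.\<close>
  define P where "P = S - N"
  have AP: "A ** P = mat 1 - N"
  proof -
    have "(A + N) ** S = A ** S + N"
      by (simp add: matrix_mult_distribs NS)
    then have "A ** S = mat 1 - N"
      by (simp add: S eq_diff_eq)
    then show ?thesis
      by (simp add: P_def matrix_mult_distribs assms)
  qed
  have PA: "P ** A = mat 1 - N"
  proof -
    have "S ** (A + N) = S ** A + N"
      by (simp add: matrix_add_ldistrib SN)
    then have "S ** A = mat 1 - N"
      by (simp add: S eq_diff_eq)
    then show ?thesis
      by (simp add: P_def matrix_mult_distribs assms)
  qed
  have "transpose (mat 1 - N) = mat 1 - N"
    using assms(4) by (simp add: transpose_def mat_def vec_eq_iff)
  then have "penrose A P"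
    unfolding penrose_def AP PA
    using assms NS by (simp add: matrix_mult_distribs P_def)
  then show ?thesis
    using AP pseudoinverse_eqI by metis
qed

section \<open>The graph Laplacian and the norm of the method\<close>

locale weighted_graph =
  fixes L :: real and E :: "'b::finite set set" and p :: "'b set \<Rightarrow> real"
  assumes L_pos: "L > 0"
    and connected: "connected_graph E"
    and probabilities: "edge_probabilities E p"
begin

text \<open>The zero diagonal lets sums over neighbours range over all of
  \<open>UNIV\<close>.\<close>

definition weight :: "'b \<Rightarrow> 'b \<Rightarrow> real" where
  "weight i j = (if i = j then 0 else p {i, j})"

lemma weight_commute: "weight i j = weight j i"
  by (simp add: weight_def insert_commute)

lemma p_nonneg: "p e \<ge> 0"
  using probabilities unfolding edge_probabilities_def by (metis less_imp_le order_refl)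

lemma weight_nonneg: "weight i j \<ge> 0"
  by (simp add: weight_def p_nonneg)

lemma edgeE:
  assumes "e \<in> E"
  obtains i j where "i \<noteq> j" "e = {i, j}"
proof -
  have "\<exists>i j. i \<noteq> j \<and> e = {i, j}"
    using connected assms unfolding connected_graph_def by (elim conjE) (rule bspec)
  then show ?thesis using that by (elim exE conjE)
qed

lemma weight_pos: "{i, j} \<in> E \<Longrightarrow> weight i j > 0"
  using probabilities edgeE[of "{i, j}"] unfolding edge_probabilities_def weight_def
  by (auto simp: doubleton_eq_iff)

text \<open>Double counting: every edge comes from exactly two ordered pairs of vertices.\<close>

lemma sum_weight: "(\<Sum>i\<in>UNIV. \<Sum>j\<in>UNIV. weight i j * g {i, j}) = 2 * (\<Sum>e\<in>E. p e * g e)"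
proof -
  let ?S = "{r :: 'b \<times> 'b. {fst r, snd r} \<in> E}"
  have "(\<Sum>i\<in>UNIV. \<Sum>j\<in>UNIV. weight i j * g {i, j}) =
      (\<Sum>r\<in>UNIV. weight (fst r) (snd r) * g {fst r, snd r})"
    by (simp add: sum.cartesian_product case_prod_unfold)
  also have "\<dots> = (\<Sum>r\<in>?S. p {fst r, snd r} * g {fst r, snd r})"
  proof (rule sum.mono_neutral_cong_right)
    show "\<forall>r\<in>UNIV - ?S. weight (fst r) (snd r) * g {fst r, snd r} = 0"
      using probabilities by (auto simp: weight_def edge_probabilities_def)
    show "weight (fst r) (snd r) * g {fst r, snd r} = p {fst r, snd r} * g {fst r, snd r}"
      if "r \<in> ?S" for r
      using that weight_pos[of "fst r" "snd r"] by (auto simp: weight_def split: if_splits)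
  qed auto
  also have "\<dots> = (\<Sum>e\<in>E. \<Sum>r\<in>{r\<in>?S. {fst r, snd r} = e}. p {fst r, snd r} * g {fst r, snd r})"
    by (rule sum.group[where g = "\<lambda>r. {fst r, snd r}", symmetric]) auto
  also have "\<dots> = (\<Sum>e\<in>E. 2 * (p e * g e))"
  proof (rule sum.cong)
    fix e assume e: "e \<in> E"
    then obtain i j where ij: "i \<noteq> j" "e = {i, j}" by (rule edgeE)
    have "{r\<in>?S. {fst r, snd r} = e} = {(i, j), (j, i)}"
      using e unfolding ij(2) doubleton_eq_iff by (auto simp: insert_commute[of j i])
    then show "(\<Sum>r | r \<in> ?S \<and> {fst r, snd r} = e. p {fst r, snd r} * g {fst r, snd r}) = 2 * (p e * g e)"
      using ij insert_commute[of j i "{}"] by (simp only:) simp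
  qed simp
  finally show ?thesis by (simp add: sum_distrib_left)
qed

abbreviation degree :: "'b \<Rightarrow> real" where
  "degree i \<equiv> \<Sum>r\<in>UNIV - {i}. p {i, r}"

lemma degree_eq: "degree i = (\<Sum>j\<in>UNIV. weight i j)"
proof -
  have "(\<Sum>j\<in>UNIV. weight i j) = (\<Sum>j\<in>UNIV - {i}. weight i j)"
    by (rule sum.mono_neutral_right) (auto simp: weight_def)
  also have "\<dots> = degree i"
    by (rule sum.cong) (auto simp: weight_def)
  finally show ?thesis ..
qed

text \<open>Since the probabilities sum to 1, an edge exists, and one of its endpoints
  \<open>t\<close> differs from \<open>i\<close>. The path from \<open>i\<close> to \<open>t\<close>
  must leave \<open>i\<close> along some edge.\<close>

lemma degree_pos: "degree i > 0"
proof -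
  have "E \<noteq> {}"
    using probabilities by (auto simp: edge_probabilities_def)
  then obtain a b where ab: "a \<noteq> b" "{a, b} \<in> E"
    by (metis edgeE ex_in_conv)
  define t where "t = (if a = i then b else a)"
  have "t \<noteq> i" "(i, t) \<in> {(u, v). {u, v} \<in> E}\<^sup>*"
    using ab connected by (auto simp: t_def connected_graph_def)
  then obtain c where "{i, c} \<in> E"
    by (auto elim: converse_rtranclE)
  then show ?thesis
    unfolding degree_eq using weight_pos weight_nonneg
    by (intro sum_pos2[of UNIV c]) auto
qed

lemma laplacian_block_mult:
  "block_mult (laplacian L p) v $ i = (\<Sum>j\<in>UNIV. (weight i j / (2 * L)) *\<^sub>R (v $ i - v $ j))"
proof -
  have "block_mult (laplacian L p) v $ i =
      (\<Sum>j\<in>UNIV. (if i = j then degree i / (2 * L) else 0) *\<^sub>R v $ j - (weight i j / (2 * L)) *\<^sub>R v $ j)"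
    unfolding block_mult_def vec_lambda_beta
  proof (rule sum.cong)
    fix j
    show "laplacian L p $ i $ j *\<^sub>R v $ j =
        (if i = j then degree i / (2 * L) else 0) *\<^sub>R v $ j - (weight i j / (2 * L)) *\<^sub>R v $ j"
      by (cases "i = j") (simp_all add: laplacian_def weight_def sum_divide_distrib)
  qed simp
  also have "\<dots> = (degree i / (2 * L)) *\<^sub>R v $ i - (\<Sum>j\<in>UNIV. (weight i j / (2 * L)) *\<^sub>R v $ j)"
    by (simp add: sum_subtractf if_distrib[of "\<lambda>c. c *\<^sub>R _"] cong: if_cong)
  also have "\<dots> = (\<Sum>j\<in>UNIV. (weight i j / (2 * L)) *\<^sub>R (v $ i - v $ j))"
    by (simp add: degree_eq scaleR_diff_right sum_subtractf scaleR_sum_left sum_divide_distrib)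
  finally show ?thesis .
qed

lemma degree_matrix_block_mult:
  "block_mult (degree_matrix L p) v $ i = (degree i / L) *\<^sub>R v $ i"
  by (simp add: block_mult_def degree_matrix_def if_distrib[of "\<lambda>c. c *\<^sub>R _"] cong: if_cong)

text \<open>Symmetrization: adding the copy of the double sum with \<open>i\<close> and
  \<open>j\<close> exchanged produces differences in both arguments, and halving turns
  \<open>2 * L\<close> into \<open>4 * L\<close>.\<close>

lemma laplacian_form:
  fixes u v :: "('v::real_inner) ^ 'b"
  shows "u \<bullet> block_mult (laplacian L p) v =
    (\<Sum>i\<in>UNIV. \<Sum>j\<in>UNIV. weight i j / (4 * L) * ((u $ i - u $ j) \<bullet> (v $ i - v $ j)))"
proof -
  let ?a = "\<lambda>i j. weight i j / (2 * L) * (u $ i \<bullet> (v $ i - v $ j))"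
  have eq: "u \<bullet> block_mult (laplacian L p) v = (\<Sum>i\<in>UNIV. \<Sum>j\<in>UNIV. ?a i j)"
    by (simp add: inner_vec_def laplacian_block_mult inner_sum_right)
  then have "2 * (u \<bullet> block_mult (laplacian L p) v) =
      (\<Sum>i\<in>UNIV. \<Sum>j\<in>UNIV. ?a i j) + (\<Sum>i\<in>UNIV. \<Sum>j\<in>UNIV. ?a j i)"
    using sum.swap[of ?a UNIV UNIV] by simp
  also have "\<dots> = (\<Sum>i\<in>UNIV. \<Sum>j\<in>UNIV. ?a i j + ?a j i)"
    by (simp add: sum.distrib)
  also have "\<dots> = (\<Sum>i\<in>UNIV. \<Sum>j\<in>UNIV. 2 * (weight i j / (4 * L) * ((u $ i - u $ j) \<bullet> (v $ i - v $ j))))"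
  proof (intro sum.cong refl)
    fix i j
    show "?a i j + ?a j i = 2 * (weight i j / (4 * L) * ((u $ i - u $ j) \<bullet> (v $ i - v $ j)))"
      using weight_commute[of j i] by (simp add: inner_diff_left inner_diff_right algebra_simps)
  qed
  finally show ?thesis unfolding sum_distrib_left[symmetric] by simp
qed

lemma degree_matrix_form:
  fixes u v :: "('v::real_inner) ^ 'b"
  shows "u \<bullet> block_mult (degree_matrix L p) v = (\<Sum>i\<in>UNIV. degree i / L * (u $ i \<bullet> v $ i))"
  by (simp add: inner_vec_def degree_matrix_block_mult)

text \<open>A vanishing sum of nonnegative terms kills the difference across every edge, and paths
  carry the equality to any two vertices.\<close>

lemma laplacian_form_0_imp_constant:
  fixes v :: "('v::real_inner) ^ 'b"
  assumes "v \<bullet> block_mult (laplacian L p) v = 0"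
  shows "v $ i = v $ j"
proof -
  have "weight i j / (4 * L) * ((v $ i - v $ j) \<bullet> (v $ i - v $ j)) = 0" for i j
    using assms L_pos weight_nonneg
    by (simp add: laplacian_form sum_nonneg sum_nonneg_eq_0_iff)
  then have edge: "v $ i = v $ j" if "{i, j} \<in> E" for i j
    using weight_pos[OF that] L_pos that by (metis divide_eq_0_iff inner_eq_zero_iff less_irrefl mult_eq_0_iff mult_pos_pos right_minus_eq zero_less_numeral)
  have "(i, j) \<in> {(u, v). {u, v} \<in> E}\<^sup>*"
    using connected by (simp add: connected_graph_def)
  then show ?thesis
    by (induction rule: rtrancl_induct) (use edge in auto)
qed

text \<open>The matrix subtracted averages all entries: it is the orthogonal projection onto the
  constant vectors, which form the kernel of the Laplacian.\<close>

lemma laplacian_pseudoinverse: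
  "laplacian L p ** pseudoinverse (laplacian L p) = mat 1 - (\<chi> i j. 1 / real CARD('b))"
proof (rule pseudoinverse_regularized)
  let ?A = "laplacian L p" and ?N = "(\<chi> i j. 1 / real CARD('b)) :: real ^ 'b ^ 'b"
  have row: "(\<Sum>j\<in>UNIV. ?A $ i $ j) = 0" for i
    using laplacian_block_mult[of "(\<chi> i. 1) :: real ^ 'b" i] by (simp add: block_mult_def)
  have sym: "?A $ i $ j = ?A $ j $ i" for i j
    by (simp add: laplacian_def insert_commute)
  have col: "(\<Sum>i\<in>UNIV. ?A $ i $ j) = 0" for j
    using row[of j] by (simp add: sym[of _ j])
  show "?A ** ?N = 0"
    by (simp add: matrix_matrix_mult_def vec_eq_iff sum_divide_distrib[symmetric] row)
  show "?N ** ?A = 0"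
    by (simp add: matrix_matrix_mult_def vec_eq_iff sum_divide_distrib[symmetric] col)
  show "?N ** ?N = ?N"
    by (simp add: matrix_matrix_mult_def vec_eq_iff)
  show "transpose ?N = ?N"
    by (simp add: transpose_def)
  \<comment> \<open>Both quadratic forms are nonnegative and add up to zero. The Laplacian one makes
    \<open>w\<close> constant, the averaging one makes its entries sum to zero.\<close>
  have "w = 0" if w: "(?A + ?N) *v w = 0" for w
  proof -
    have N: "?N *v w = (\<chi> i. (\<Sum>j\<in>UNIV. w $ j) / CARD('b))"
      by (simp add: matrix_vector_mult_def vec_eq_iff sum_divide_distrib)
    have wN: "w \<bullet> (?N *v w) = (\<Sum>j\<in>UNIV. w $ j)\<^sup>2 / CARD('b)"
      unfolding N by (simp add: inner_vec_def sum_distrib_right[symmetric] sum_divide_distrib[symmetric] power2_eq_square)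
    have "w \<bullet> (?A *v w) + w \<bullet> (?N *v w) = 0"
      using w by (metis inner_add_right inner_zero_right matrix_vector_mult_add_rdistrib)
    moreover have "w \<bullet> (?A *v w) \<ge> 0"
      unfolding block_mult_real_eq[symmetric] laplacian_form
      using L_pos weight_nonneg by (intro sum_nonneg mult_nonneg_nonneg) auto
    moreover have "w \<bullet> (?N *v w) \<ge> 0"
      unfolding wN by simp
    ultimately have A0: "w \<bullet> (?A *v w) = 0" and N0: "w \<bullet> (?N *v w) = 0"
      by linarith+
    have s: "(\<Sum>j\<in>UNIV. w $ j) = 0"
      using N0 unfolding wN by simp
    have c: "w $ i = w $ j" for i j
      by (rule laplacian_form_0_imp_constant) (simp add: block_mult_real_eq A0)
    have "w $ i = 0" for i
    proof -
      have "(\<Sum>j\<in>UNIV. w $ j) = (\<Sum>j::'b\<in>UNIV. w $ i)"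
        by (rule sum.cong) (auto intro: c)
      then show ?thesis using s by simp
    qed
    then show "w = 0" by (simp add: vec_eq_iff)
  qed
  then show "invertible (?A + ?N)"
    by (auto simp: invertible_left_inverse matrix_left_invertible_ker)
qed

section \<open>The semidefinite form of \<open>K\<close> and its Cauchy-Schwarz inequality\<close>

definition kform :: "('b, 'y::finite, 'z::finite) point \<Rightarrow> ('b, 'y, 'z) point \<Rightarrow> real" where
  "kform u v = fst u \<bullet> block_mult (laplacian L p) (fst v) + snd u \<bullet> block_mult (degree_matrix L p) (snd v)"

lemma kform_eq:
  "kform u v =
    (\<Sum>i\<in>UNIV. \<Sum>j\<in>UNIV. weight i j / (4 * L) * ((fst u $ i - fst u $ j) \<bullet> (fst v $ i - fst v $ j))) +
    (\<Sum>i\<in>UNIV. degree i / L * (snd u $ i \<bullet> snd v $ i))"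
  by (simp add: kform_def laplacian_form degree_matrix_form)

lemma kform_nonneg: "kform u u \<ge> 0"
  unfolding kform_eq using L_pos weight_nonneg degree_pos[THEN less_imp_le]
  by (intro add_nonneg_nonneg sum_nonneg mult_nonneg_nonneg) auto

lemma kform_line: "kform (u - t *\<^sub>R v) (u - t *\<^sub>R v) = kform u u - 2 * t * kform u v + t\<^sup>2 * kform v v"
proof -
  have 1: "((a - t *\<^sub>R b) - (a' - t *\<^sub>R b')) \<bullet> ((a - t *\<^sub>R b) - (a' - t *\<^sub>R b')) =
      (a - a') \<bullet> (a - a') - 2 * t * ((a - a') \<bullet> (b - b')) + t\<^sup>2 * ((b - b') \<bullet> (b - b'))"
    for a b a' b' :: "'v::real_inner"
    by (simp add: inner_diff_left inner_diff_right power2_eq_square inner_commute algebra_simps)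
  have 2: "(a - t *\<^sub>R b) \<bullet> (a - t *\<^sub>R b) = a \<bullet> a - 2 * t * (a \<bullet> b) + t\<^sup>2 * (b \<bullet> b)"
    for a b :: "'v::real_inner"
    by (simp add: inner_diff_left inner_diff_right power2_eq_square inner_commute algebra_simps)
  show ?thesis
    unfolding kform_eq fst_diff snd_diff fst_scaleR snd_scaleR vector_minus_component
      vector_scaleR_component 1 2
    by (simp add: distrib_left right_diff_distrib sum.distrib sum_subtractf sum_distrib_left ac_simps)
qed

text \<open>\<open>kform\<close> is only semidefinite, so \<open>kform v v = 0\<close> is a separate
  case: there \<open>kform_line\<close> is affine in \<open>t\<close>, and staying nonnegative
  forces its slope to vanish.\<close>

lemma kform_Cauchy_Schwarz: "(kform u v)\<^sup>2 \<le> kform u u * kform v v"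
proof (cases "kform v v = 0")
  case True
  have "kform u v = 0"
  proof (rule ccontr)
    assume "kform u v \<noteq> 0"
    then show False
      \<comment> \<open>This value of \<open>t\<close> makes the affine expression equal to
        -1.\<close>
      using kform_nonneg[of "u - ((kform u u + 1) / (2 * kform u v)) *\<^sub>R v"]
      by (simp add: kform_line True)
  qed
  then show ?thesis by (simp add: kform_nonneg)
next
  case False
  then have "kform v v > 0" using kform_nonneg[of v] by linarith
  \<comment> \<open>\<open>t = kform u v / kform v v\<close> minimizes the quadratic in
    \<open>t\<close>.\<close>
  moreover have "0 \<le> kform u u - 2 * (kform u v / kform v v) * kform u v + (kform u v / kform v v)\<^sup>2 * kform v v"
    using kform_nonneg[of "u - (kform u v / kform v v) *\<^sub>R v"] unfolding kform_line .
  ultimately show ?thesis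
    by (simp add: field_simps power2_eq_square)
qed

lemma degree_matrix_inverse:
  "degree_matrix L p ** matrix_inv (degree_matrix L p) = mat 1"
proof -
  have "degree_matrix L p ** (\<chi> i j. if i = j then L / degree i else 0) = mat 1"
    using degree_pos L_pos
    by (simp add: matrix_matrix_mult_def degree_matrix_def mat_def vec_eq_iff less_imp_neq[symmetric]
        if_distrib[of "\<lambda>t. _ * t"] if_distrib[of "\<lambda>t. t * _"] cong: if_cong)
  then have "invertible (degree_matrix L p)"
    by (auto simp: invertible_right_inverse)
  then show ?thesis
    unfolding invertible_def matrix_inv_def by (rule someI2_ex) simp
qed

text \<open>The gradient pairing factors through \<open>K\<close> on feasible directions: \<open>v = K K\<^sup>+ v\<close>.\<close>

lemma inner_sq_le_kform_dual_norm:
  fixes u v :: "('b, 'y::finite, 'z::finite) point"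
  assumes "feasible v"
  shows "0 \<le> dual_norm L p v" "(u \<bullet> v)\<^sup>2 \<le> kform u u * (dual_norm L p v)\<^sup>2"
proof -
  define w where "w = (block_mult (pseudoinverse (laplacian L p)) (fst v),
                       block_mult (matrix_inv (degree_matrix L p)) (snd v))"
  \<comment> \<open>Feasibility says that the \<open>y\<close> blocks sum to zero, so averaging
    annihilates them.\<close>
  have "block_mult (mat 1 - (\<chi> i j. 1 / real CARD('b))) (fst v) = block_mult (mat 1) (fst v)"
    using assms
    by (simp add: block_mult_def feasible_def vec_eq_iff scaleR_diff_left sum_subtractf scaleR_sum_right[symmetric])
  then have w: "block_mult (laplacian L p) (fst w) = fst v" "block_mult (degree_matrix L p) (snd w) = snd v"
    unfolding w_def fst_conv snd_conv block_mult_matrix_mul[symmetric] laplacian_pseudoinverse degree_matrix_inverse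
    by simp_all
  have inner: "u \<bullet> v = kform u w" for u
    by (simp add: kform_def w inner_prod_def)
  have "dual_norm L p v = sqrt (v \<bullet> w)"
    by (simp add: dual_norm_def inner_kronecker_mat_1 w_def inner_prod_def)
  \<comment> \<open>Since \<open>v\<close> is \<open>K\<close> applied to \<open>w\<close>, the dual
    norm of \<open>v\<close> is the \<open>K\<close>-norm of \<open>w\<close>, and Cauchy-Schwarz
    applies to \<open>u\<close> and \<open>w\<close>.\<close>
  then have "dual_norm L p v = sqrt (kform w w)"
    by (simp add: inner[symmetric] inner_commute)
  then show "0 \<le> dual_norm L p v" "(u \<bullet> v)\<^sup>2 \<le> kform u u * (dual_norm L p v)\<^sup>2"
    using kform_Cauchy_Schwarz[of u w] by (simp_all add: kform_nonneg inner)
qed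

end

section \<open>One step of the method\<close>

lemma inner_embed_pair: "g \<bullet> embed_pair i j d = block_pair i j g \<bullet> d"
  by (simp add: embed_pair_def embed_def block_pair_def block_def inner_prod_def inner_add_right inner_axis)

lemma GDERIV_line:
  assumes "GDERIV f (x + t *\<^sub>R v) :> g"
  shows "((\<lambda>t. f (x + t *\<^sub>R v)) has_field_derivative g \<bullet> v) (at t)"
proof -
  have "((\<lambda>t. x + t *\<^sub>R v) has_derivative (\<lambda>t. t *\<^sub>R v)) (at t)"
    by (auto intro!: derivative_eq_intros)
  from has_derivative_compose[OF this assms[unfolded gderiv_def]]
  have "((\<lambda>t. f (x + t *\<^sub>R v)) has_derivative (\<lambda>s. (s *\<^sub>R v) \<bullet> g)) (at t)" .
  then show ?thesis
    by (simp add: has_field_derivative_def inner_commute[of v] mult_commute_abs)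
qed

text \<open>Restricting \<open>f\<close> to the line through \<open>x\<close> and \<open>y\<close>
  reduces the claim to the tangent inequality for convex functions of one real variable.\<close>

lemma tangent_line_le:
  fixes f :: "'a::real_inner \<Rightarrow> real"
  assumes "convex_on UNIV f" "GDERIV f x :> g"
  shows "f x + g \<bullet> (y - x) \<le> f y"
proof -
  define h where "h t = f (x + t *\<^sub>R (y - x))" for t
  have "convex_on UNIV h"
  proof (rule convex_onI)
    fix t a b :: real
    assume t: "0 < t" "t < 1"
    have "x + ((1 - t) *\<^sub>R a + t *\<^sub>R b) *\<^sub>R (y - x) =
        (1 - t) *\<^sub>R (x + a *\<^sub>R (y - x)) + t *\<^sub>R (x + b *\<^sub>R (y - x))"
      by (simp add: algebra_simps)
    then show "h ((1 - t) *\<^sub>R a + t *\<^sub>R b) \<le> (1 - t) * h a + t * h b"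
      unfolding h_def using convex_onD[OF assms(1), of t] t by simp
  qed simp
  moreover have "(h has_field_derivative g \<bullet> (y - x)) (at 0)"
    unfolding h_def using assms(2) by (intro GDERIV_line) simp
  ultimately have "g \<bullet> (y - x) * (1 - 0) \<le> h 1 - h 0"
    by (intro convex_on_imp_above_tangent[where A = UNIV]) auto
  then show ?thesis by (simp add: h_def)
qed

text \<open>\<open>h\<close> is \<open>f\<close> along the segment minus its linear and quadratic
  model terms. The Lipschitz bound makes the derivative of \<open>h\<close> nonpositive for
  \<open>t\<close> at least 0, and \<open>h 1 \<le> h 0\<close> is the claim.\<close>

lemma edge_descent:
  assumes gderiv: "\<And>x. GDERIV f x :> gf x" and lip: "edge_lipschitz L E gf" and ij: "{i, j} \<in> E"
  shows "f (x + embed_pair i j d) \<le> pair_model f gf L 1 i j x d"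
proof -
  let ?v = "embed_pair i j d"
  define h where "h t = f (x + t *\<^sub>R ?v) - t * (block_pair i j (gf x) \<bullet> d) - L / 2 * (norm d)\<^sup>2 * t\<^sup>2" for t
  have scale: "t *\<^sub>R ?v = embed_pair i j (t *\<^sub>R d)" for t
    by (simp add: embed_pair_def embed_def vec_eq_iff axis_def algebra_simps)
  have "\<exists>D. (h has_field_derivative D) (at t) \<and> D \<le> 0" if "0 \<le> t" for t
  proof (intro exI conjI)
    have "((\<lambda>t. f (x + t *\<^sub>R ?v)) has_field_derivative block_pair i j (gf (x + t *\<^sub>R ?v)) \<bullet> d) (at t)"
      unfolding inner_embed_pair[symmetric] using gderiv by (rule GDERIV_line)
    then show "(h has_field_derivative (block_pair i j (gf (x + t *\<^sub>R ?v)) \<bullet> d -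
        block_pair i j (gf x) \<bullet> d - L * (norm d)\<^sup>2 * t)) (at t)"
      unfolding h_def by (auto intro!: derivative_eq_intros)
    have "block_pair i j (gf (x + t *\<^sub>R ?v)) \<bullet> d - block_pair i j (gf x) \<bullet> d
        \<le> norm (block_pair i j (gf (x + t *\<^sub>R ?v)) - block_pair i j (gf x)) * norm d"
      unfolding inner_diff_left[symmetric] by (rule norm_cauchy_schwarz)
    also have "\<dots> \<le> L * norm (t *\<^sub>R d) * norm d"
      using lip ij unfolding scale edge_lipschitz_def by (intro mult_right_mono) (blast, rule norm_ge_zero)
    finally show "block_pair i j (gf (x + t *\<^sub>R ?v)) \<bullet> d - block_pair i j (gf x) \<bullet> d - L * (norm d)\<^sup>2 * t \<le> 0"
      using that by (simp add: power2_eq_square mult_ac)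
  qed
  then have "h 1 \<le> h 0"
    by (intro DERIV_nonpos_imp_nonincreasing[of 0 1]) auto
  then show ?thesis
    by (simp add: h_def pair_model_def)
qed

text \<open>The minimizer of the model for step size 1: the negative pair gradient over
  \<open>L\<close>, projected onto the directions with opposite \<open>y\<close>-parts. The
  projection causes the factor \<open>1 / (2 * L)\<close>.\<close>

definition pair_direction ::
  "real \<Rightarrow> 'b \<Rightarrow> 'b \<Rightarrow> ('b::finite, 'y::finite, 'z::finite) point \<Rightarrow> ('y, 'z) block \<times> ('y, 'z) block" where
  "pair_direction L i j g =
    (((1 / (2 * L)) *\<^sub>R (fst g $ j - fst g $ i), - (1 / L) *\<^sub>R snd g $ i),
     ((1 / (2 * L)) *\<^sub>R (fst g $ i - fst g $ j), - (1 / L) *\<^sub>R snd g $ j))"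

text \<open>The amount by which the model drops below \<open>f x\<close> at
  \<open>pair_direction\<close>.\<close>

definition pair_decrease ::
  "real \<Rightarrow> 'b \<Rightarrow> 'b \<Rightarrow> ('b::finite, 'y::finite, 'z::finite) point \<Rightarrow> real" where
  "pair_decrease L i j g =
    1 / (4 * L) * ((fst g $ i - fst g $ j) \<bullet> (fst g $ i - fst g $ j)) +
    1 / (2 * L) * (snd g $ i \<bullet> snd g $ i + snd g $ j \<bullet> snd g $ j)"

text \<open>A description of the step that does not name the endpoints of \<open>e\<close>.\<close>

definition pair_step ::
  "real \<Rightarrow> (('b::finite, 'y::finite, 'z::finite) point \<Rightarrow> ('b, 'y, 'z) point) \<Rightarrow> 'b set \<Rightarrow>
    ('b, 'y, 'z) point \<Rightarrow> ('b, 'y, 'z) point" where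
  "pair_step L gf e x = x +
    ((\<chi> i. if i \<in> e then (1 / (2 * L)) *\<^sub>R ((\<Sum>j\<in>e. fst (gf x) $ j) - 2 *\<^sub>R fst (gf x) $ i) else 0),
     (\<chi> i. if i \<in> e then - (1 / L) *\<^sub>R snd (gf x) $ i else 0))"

text \<open>The sum of the gradient components over the edge, minus twice the own component, is the
  other component minus the own one.\<close>

lemma pair_step_eq:
  "i \<noteq> j \<Longrightarrow> pair_step L gf {i, j} x = x + embed_pair i j (pair_direction L i j (gf x))"
  by (auto simp: pair_step_def embed_pair_def embed_def pair_direction_def vec_eq_iff axis_def
      scaleR_2 algebra_simps)

lemma pair_direction_feasible: "pair_feasible (pair_direction L i j g)"
  by (simp add: pair_feasible_def pair_direction_def scaleR_add_right[symmetric])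

text \<open>\<open>- L\<close> times \<open>pair_direction\<close> is the projection of the pair
  gradient onto the feasible directions, so both pair equally with a feasible
  \<open>d\<close>.\<close>

lemma block_pair_inner:
  assumes "L > 0" "pair_feasible d"
  shows "block_pair i j g \<bullet> d = - L * (pair_direction L i j g \<bullet> d)"
proof -
  have "fst (snd d) = - fst (fst d)"
    using assms(2) by (simp add: pair_feasible_def eq_neg_iff_add_eq_0 add.commute)
  then show ?thesis
    using assms(1)
    by (simp add: block_pair_def block_def pair_direction_def inner_prod_def inner_diff_left field_simps)
qed

lemma norm_pair_direction:
  assumes "L > 0"
  shows "L / 2 * (norm (pair_direction L i j g))\<^sup>2 = pair_decrease L i j g"
proof -
  have eq: "pair_direction L i j g \<bullet> pair_direction L i j g =
    1 / (2 * L\<^sup>2) * ((fst g $ i - fst g $ j) \<bullet> (fst g $ i - fst g $ j)) +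
    1 / L\<^sup>2 * (snd g $ i \<bullet> snd g $ i + snd g $ j \<bullet> snd g $ j)"
    using assms
    by (simp add: pair_direction_def inner_prod_def inner_diff_left inner_diff_right inner_commute
      field_simps power2_eq_square)
  show ?thesis
    unfolding power2_norm_eq_inner pair_decrease_def eq
    using assms by (simp add: field_simps power2_eq_square)
qed

text \<open>Completing the square; this exhibits both the unique minimizer and the minimal
  value.\<close>

lemma pair_model_eq:
  assumes "L > 0" "pair_feasible d"
  shows "pair_model f gf L 1 i j x d =
    f x + L / 2 * (norm (d - pair_direction L i j (gf x)))\<^sup>2 - pair_decrease L i j (gf x)"
  unfolding pair_model_def block_pair_inner[OF assms] norm_pair_direction[OF assms(1), symmetric]
  by (simp add: power2_norm_eq_inner inner_diff_left inner_diff_right inner_commute algebra_simps)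

text \<open>Comparing the minimizer with \<open>pair_direction\<close> leaves a square that is at
  most zero. The iterates are thus determined by the drawn edges.\<close>

lemma descent_step_imp_pair_step:
  assumes "L > 0" "descent_step f gf L 1 e x x'"
  shows "x' = pair_step L gf e x"
proof -
  obtain i j d where ij: "i \<noteq> j" "e = {i, j}" "x' = x + embed_pair i j d"
    and min: "is_arg_min (pair_model f gf L 1 i j x) pair_feasible d"
    using assms(2) unfolding descent_step_def by (elim exE conjE)
  let ?d = "pair_direction L i j (gf x)"
  have "pair_feasible d" "pair_model f gf L 1 i j x d \<le> pair_model f gf L 1 i j x ?d"
    using min pair_direction_feasible[of L i j "gf x"] unfolding is_arg_min_def not_less[symmetric] by blast+
  then have "L / 2 * (norm (d - ?d))\<^sup>2 \<le> 0"
    by (simp add: pair_model_eq[OF assms(1)] pair_direction_feasible)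
  then have "d = ?d"
    using assms(1) by (simp add: mult_le_0_iff)
  then show ?thesis
    unfolding ij(2,3) pair_step_eq[OF ij(1)] by simp
qed

lemma pair_step_feasible:
  fixes x :: "('b::finite, 'y::finite, 'z::finite) point"
  assumes "i \<noteq> j" "feasible x"
  shows "feasible (pair_step L gf {i, j} x)"
proof -
  have "(\<Sum>k\<in>UNIV. axis i u $ k) = u" for i :: 'b and u :: "real ^ 'y"
    by (simp add: axis_def)
  then show ?thesis
    using assms pair_direction_feasible[of L i j "gf x"]
    by (simp add: pair_step_eq feasible_def pair_feasible_def embed_pair_def embed_def sum.distrib)
qed

lemma pair_step_decrease:
  assumes "L > 0" "\<And>x. GDERIV f x :> gf x" "edge_lipschitz L E gf" "{i, j} \<in> E" "i \<noteq> j"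
  shows "f (pair_step L gf {i, j} x) \<le> f x - pair_decrease L i j (gf x)"
  using edge_descent[OF assms(2-4), of x "pair_direction L i j (gf x)"] assms(1,5)
  by (simp add: pair_step_eq pair_model_eq pair_direction_feasible)

lemma pair_decrease_nonneg: "L > 0 \<Longrightarrow> pair_decrease L i j g \<ge> 0"
  by (simp add: pair_decrease_def)

section \<open>Expected decrease and optimality gap at a given point\<close>

locale pair_descent = weighted_graph L E p
  for L :: real and E :: "'b::finite set set" and p :: "'b set \<Rightarrow> real" +
  fixes f :: "('b, 'y::finite, 'z::finite) point \<Rightarrow> real"
    and gf :: "('b, 'y, 'z) point \<Rightarrow> ('b, 'y, 'z) point"
  assumes f_convex: "convex_on UNIV f"
    and f_gderiv: "\<And>x. GDERIV f x :> gf x"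
    and lipschitz: "edge_lipschitz L E gf"
begin

abbreviation step :: "'b set \<Rightarrow> ('b, 'y, 'z) point \<Rightarrow> ('b, 'y, 'z) point" where
  "step e x \<equiv> pair_step L gf e x"

lemma sum_p: "(\<Sum>e\<in>E. p e) = 1"
  using probabilities by (simp add: edge_probabilities_def)

lemma step_feasible: "e \<in> E \<Longrightarrow> feasible x \<Longrightarrow> feasible (step e x)"
  by (elim edgeE) (simp add: pair_step_feasible)

text \<open>Monotonicity along every path keeps the iterates in the level set over which
  \<open>radius\<close> is taken.\<close>

lemma step_le: "e \<in> E \<Longrightarrow> f (step e x) \<le> f x"
proof -
  assume e: "e \<in> E"
  then obtain i j where ij: "i \<noteq> j" "e = {i, j}" by (rule edgeE)
  show ?thesis
    using pair_step_decrease[OF L_pos f_gderiv lipschitz e[unfolded ij(2)] ij(1), of x]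
      pair_decrease_nonneg[OF L_pos, of i j "gf x"] unfolding ij(2) by linarith
qed

text \<open>The \<open>y\<close> terms match the Laplacian form. In the \<open>z\<close> terms each
  vertex is counted once as first and once as second endpoint, and two halves give
  \<open>degree i / L\<close>.\<close>

lemma sum_weight_pair_decrease:
  "(\<Sum>i\<in>UNIV. \<Sum>j\<in>UNIV. weight i j * pair_decrease L i j (g :: ('b, 'y, 'z) point)) = kform g g"
proof -
  let ?z = "\<lambda>i. snd g $ i \<bullet> snd g $ i"
  have "(\<Sum>i\<in>UNIV. \<Sum>j\<in>UNIV. weight i j / (2 * L) * ?z j) = (\<Sum>i\<in>UNIV. \<Sum>j\<in>UNIV. weight i j / (2 * L) * ?z i)"
    by (subst sum.swap) (simp add: weight_commute)
  moreover have "(\<Sum>i\<in>UNIV. \<Sum>j\<in>UNIV. weight i j / (2 * L) * ?z i) + (\<Sum>i\<in>UNIV. \<Sum>j\<in>UNIV. weight i j / (2 * L) * ?z i)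
      = (\<Sum>i\<in>UNIV. degree i / L * ?z i)"
    unfolding sum.distrib[symmetric] degree_eq sum_divide_distrib sum_distrib_right by simp
  moreover have "(\<Sum>i\<in>UNIV. \<Sum>j\<in>UNIV. weight i j * pair_decrease L i j g) =
      (\<Sum>i\<in>UNIV. \<Sum>j\<in>UNIV. weight i j / (4 * L) * ((fst g $ i - fst g $ j) \<bullet> (fst g $ i - fst g $ j))) +
      ((\<Sum>i\<in>UNIV. \<Sum>j\<in>UNIV. weight i j / (2 * L) * ?z i) + (\<Sum>i\<in>UNIV. \<Sum>j\<in>UNIV. weight i j / (2 * L) * ?z j))"
    unfolding sum.distrib[symmetric] pair_decrease_def
    by (intro sum.cong refl) (simp add: distrib_left add_divide_distrib)
  ultimately show ?thesis
    unfolding kform_eq by simp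
qed

text \<open>Summing over ordered pairs counts each edge twice, whence the division by 2.\<close>

lemma expected_decrease: "(\<Sum>e\<in>E. p e * f (step e x)) \<le> f x - kform (gf x) (gf x) / 2"
proof -
  have "2 * (\<Sum>e\<in>E. p e * f (step e x)) = (\<Sum>i\<in>UNIV. \<Sum>j\<in>UNIV. weight i j * f (step {i, j} x))"
    by (rule sum_weight[symmetric])
  also have "\<dots> \<le> (\<Sum>i\<in>UNIV. \<Sum>j\<in>UNIV. weight i j * (f x - pair_decrease L i j (gf x)))"
  proof (intro sum_mono)
    fix i j
    show "weight i j * f (step {i, j} x) \<le> weight i j * (f x - pair_decrease L i j (gf x))"
    proof (cases "i \<noteq> j \<and> {i, j} \<in> E")
      case True
      then show ?thesis
        using pair_step_decrease[OF L_pos f_gderiv lipschitz] weight_nonneg by (simp add: mult_left_mono)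
    next
      case False
      then have "weight i j = 0"
        using probabilities unfolding edge_probabilities_def weight_def by auto
      then show ?thesis by simp
    qed
  qed
  also have "\<dots> = f x * (\<Sum>i\<in>UNIV. \<Sum>j\<in>UNIV. weight i j * 1) - kform (gf x) (gf x)"
    by (simp add: right_diff_distrib sum_subtractf sum_weight_pair_decrease sum_distrib_left mult.commute)
  also have "\<dots> = 2 * f x - kform (gf x) (gf x)"
    unfolding sum_weight[of "\<lambda>_. 1"] by (simp add: sum_p)
  finally show ?thesis by simp
qed

lemma gap_le:
  assumes x: "feasible x" and xs: "xs \<in> optimal_set f"
  shows "(f x - f xs)\<^sup>2 \<le> kform (gf x) (gf x) * (dual_norm L p (x - xs))\<^sup>2"
    and "0 \<le> dual_norm L p (x - xs)" and "f xs \<le> f x"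
proof -
  have fs: "feasible xs" and le: "f xs \<le> f x"
    using xs x unfolding optimal_set_def is_arg_min_def mem_Collect_eq not_less[symmetric] by blast+
  have "feasible (x - xs)"
    using x fs by (simp add: feasible_def sum_subtractf)
  note dual = inner_sq_le_kform_dual_norm[OF this]
  then show "0 \<le> dual_norm L p (x - xs)" by blast
  have "f x - f xs \<le> gf x \<bullet> (x - xs)"
    using tangent_line_le[OF f_convex f_gderiv, of x xs] by (simp add: inner_diff_right)
  \<comment> \<open>Squaring preserves the inequality because the gap is nonnegative by optimality
    of \<open>xs\<close>.\<close>
  then have "(f x - f xs)\<^sup>2 \<le> (gf x \<bullet> (x - xs))\<^sup>2"
    using le by (intro power_mono) auto
  also have "\<dots> \<le> kform (gf x) (gf x) * (dual_norm L p (x - xs))\<^sup>2"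
    by (rule dual)
  finally show "(f x - f xs)\<^sup>2 \<le> kform (gf x) (gf x) * (dual_norm L p (x - xs))\<^sup>2" .
  show "f xs \<le> f x" by (rule le)
qed

end

section \<open>Radius, optimal value and the scalar recursion\<close>

lemma attains_max_upper:
  "attains_max g S \<Longrightarrow> x \<in> S \<Longrightarrow> g x \<le> (SUP y\<in>S. g y :: real)"
  \<comment> \<open>The attained maximum supplies the upper bound that makes the real supremum
    meaningful.\<close>
  unfolding attains_max_def by (auto intro!: cSUP_upper bdd_aboveI2)

lemma dual_norm_le_radius:
  assumes "radius_exists f L p x0" "f x \<le> f x0" "xs \<in> optimal_set f"
  shows "dual_norm L p (x - xs) \<le> radius f L p x0"
proof -
  have "dual_norm L p (x - xs) \<le> farthest_optimum f L p x"
    unfolding farthest_optimum_def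
    by (rule attains_max_upper) (use assms in \<open>unfold radius_exists_def, blast+\<close>)
  also have "\<dots> \<le> radius f L p x0"
    using assms unfolding radius_exists_def radius_def by (intro attains_max_upper) auto
  finally show ?thesis .
qed

lemma optimal_value_eq:
  assumes "xs \<in> optimal_set f"
  shows "optimal_value f = f xs"
  unfolding optimal_value_def
  by (rule cInf_eq_minimum) (use assms in \<open>auto simp: optimal_set_def is_arg_min_def not_less\<close>)

text \<open>With \<open>a = D n\<close>, the recursion gives
  \<open>c * D (Suc n) \<le> a * (c - a)\<close>. Multiplying by \<open>n + 1\<close> and using
  \<open>n * a \<le> c\<close> bounds the right side by \<open>(c + a) * (c - a)\<close>, which is
  at most \<open>c * c\<close>.\<close>

lemma quadratic_recursion_bound:
  fixes D :: "nat \<Rightarrow> real"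
  assumes nonneg: "\<And>n. 0 \<le> D n" and rec: "\<And>n. (D n)\<^sup>2 \<le> c * (D n - D (Suc n))" and "0 \<le> c"
  shows "real n * D n \<le> c"
proof (induction n)
  case 0
  then show ?case using \<open>0 \<le> c\<close> by simp
next
  case (Suc n)
  show ?case
  proof (cases "c = 0")
    case True
    then have "D (Suc n) = 0"
      using rec[of "Suc n"] by simp
    then show ?thesis using True by simp
  next
    case False
    then have c: "c > 0" using \<open>0 \<le> c\<close> by simp
    let ?a = "D n"
    have a: "?a * ?a \<le> c * ?a - c * D (Suc n)"
      using rec[of n] by (simp add: power2_eq_square right_diff_distrib)
    then have "?a * ?a \<le> c * ?a"
      using mult_nonneg_nonneg[of c "D (Suc n)"] nonneg[of "Suc n"] c by linarith
    \<comment> \<open>Needed so that the induction hypothesis may be multiplied by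
      \<open>c - ?a\<close>.\<close>
    then have "?a \<le> c"
      using nonneg[of n] c by (cases "?a = 0") (auto simp: mult_le_cancel_right)
    then have "real n * ?a * (c - ?a) \<le> c * (c - ?a)"
      using Suc.IH by (intro mult_right_mono) auto
    moreover have "real (Suc n) * (c * D (Suc n)) \<le> real (Suc n) * (c * ?a - ?a * ?a)"
      using a by (intro mult_left_mono) auto
    ultimately have "c * (real (Suc n) * D (Suc n)) \<le> c * c - ?a * ?a"
      by (simp add: algebra_simps)
    then have "c * (real (Suc n) * D (Suc n)) \<le> c * c"
      using zero_le_square[of ?a] by linarith
    then show ?thesis using c by simp
  qed
qed

section \<open>The random run\<close>

primrec run :: "('e \<Rightarrow> 'x \<Rightarrow> 'x) \<Rightarrow> 'x \<Rightarrow> (nat \<Rightarrow> 'e) \<Rightarrow> nat \<Rightarrow> 'x" where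
  "run T x e 0 = x"
| "run T x e (Suc n) = T (e n) (run T x e n)"

lemma run_cong: "(\<And>i. i < n \<Longrightarrow> e i = e' i) \<Longrightarrow> run T x e n = run T x e' n"
  by (induction n) auto

text \<open>The state at time \<open>n\<close> depends only on the edges before \<open>n\<close>,
  hence is a function on a finite product space.\<close>

lemma run_restrict: "run T x (restrict e {..<n}) n = run T x e n"
  by (rule run_cong) simp

context prob_space
begin

text \<open>A finite product of finite discrete spaces is discrete, so every function of the first
  \<open>n\<close> edges is measurable.\<close>

lemma PiM_count_space_lessThan:
  "PiM {..<n::nat} (\<lambda>_. count_space (UNIV :: 'e::finite set)) = count_space ({..<n} \<rightarrow>\<^sub>E UNIV)"
  by (rule count_space_PiM_finite) auto

lemma integrable_run:
  fixes edge :: "nat \<Rightarrow> 'a \<Rightarrow> 'e::finite" and h :: "'x \<Rightarrow> real"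
  assumes "indep_vars (\<lambda>_. count_space UNIV) edge UNIV"
  shows "integrable M (\<lambda>\<omega>. h (run T x (\<lambda>i. edge i \<omega>) n))"
proof -
  let ?r = "\<lambda>\<omega>. restrict (\<lambda>i. edge i \<omega>) {..<n}"
  have "\<And>i. edge i \<in> measurable M (count_space UNIV)"
    using assms by (simp add: indep_vars_def)
  then have "?r \<in> measurable M (PiM {..<n} (\<lambda>_. count_space UNIV))"
    by (intro measurable_restrict) auto
  then have meas: "(\<lambda>\<omega>. h (run T x (?r \<omega>) n)) \<in> borel_measurable M"
    unfolding PiM_count_space_lessThan by (rule measurable_compose) simp
  \<comment> \<open>Only finitely many edge sequences of length \<open>n\<close> exist, so the
    largest value bounds the integrand.\<close>
  let ?V = "(\<lambda>r. norm (h (run T x r n))) ` ({..<n} \<rightarrow>\<^sub>E UNIV)"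
  have "finite ?V" by (intro finite_imageI finite_PiE) auto
  then have "norm (h (run T x (?r \<omega>) n)) \<le> Max ?V" for \<omega>
    by (intro Max_ge image_eqI[where x = "?r \<omega>"] refl) (simp_all add: restrict_PiE_iff)
  then have "integrable M (\<lambda>\<omega>. h (run T x (?r \<omega>) n))"
    using meas by (intro integrable_const_bound[where B = "Max ?V"]) auto
  then show ?thesis
    by (simp add: run_restrict)
qed

text \<open>Condition on the value of edge \<open>n\<close>: it is independent of the state at time
  \<open>n\<close>, which the edges with smaller index determine.\<close>

lemma expectation_run_Suc:
  fixes edge :: "nat \<Rightarrow> 'a \<Rightarrow> 'e::finite" and h :: "'x \<Rightarrow> real"
  assumes indep: "indep_vars (\<lambda>_. count_space UNIV) edge UNIV"
  shows "expectation (\<lambda>\<omega>. h (run T x (\<lambda>i. edge i \<omega>) (Suc n))) =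
    (\<Sum>e\<in>UNIV. prob {\<omega> \<in> space M. edge n \<omega> = e} * expectation (\<lambda>\<omega>. h (T e (run T x (\<lambda>i. edge i \<omega>) n))))"
proof -
  let ?run = "\<lambda>\<omega>. run T x (\<lambda>i. edge i \<omega>) n"
  have meas [measurable]: "edge n \<in> measurable M (count_space UNIV)"
    using indep by (simp add: indep_vars_def)
  have int_ind: "integrable M (\<lambda>\<omega>. indicator {e} (edge n \<omega>) :: real)" for e
    by (intro integrable_const_bound[where B = 1]) (auto simp: indicator_def)
  have int_run: "integrable M (\<lambda>\<omega>. h (T e (?run \<omega>)))" for e
    using integrable_run[OF indep, of "\<lambda>y. h (T e y)"] .
  have indep_e: "indep_var borel (\<lambda>\<omega>. indicator {e} (edge n \<omega>) :: real) borel (\<lambda>\<omega>. h (T e (?run \<omega>)))" for e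
  proof -
    have "indep_var (PiM {n} (\<lambda>_. count_space UNIV)) (\<lambda>\<omega>. restrict (\<lambda>i. edge i \<omega>) {n})
        (PiM {..<n} (\<lambda>_. count_space UNIV)) (\<lambda>\<omega>. restrict (\<lambda>i. edge i \<omega>) {..<n})"
      by (rule indep_var_restrict[OF indep]) auto
    then have "indep_var borel ((\<lambda>r. indicator {e} (r n) :: real) \<circ> (\<lambda>\<omega>. restrict (\<lambda>i. edge i \<omega>) {n}))
        borel ((\<lambda>r. h (T e (run T x r n))) \<circ> (\<lambda>\<omega>. restrict (\<lambda>i. edge i \<omega>) {..<n}))"
    proof (rule indep_var_compose)
      show "(\<lambda>r. indicator {e} (r n) :: real) \<in> measurable (PiM {n} (\<lambda>_. count_space UNIV)) borel"
        by measurable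
      show "(\<lambda>r. h (T e (run T x r n))) \<in> measurable (PiM {..<n} (\<lambda>_. count_space UNIV)) borel"
        unfolding PiM_count_space_lessThan by simp
    qed
    then show ?thesis
      by (simp add: comp_def run_restrict)
  qed
  \<comment> \<open>For each outcome exactly one indicator is nonzero, the one of the edge
    drawn.\<close>
  have "expectation (\<lambda>\<omega>. h (run T x (\<lambda>i. edge i \<omega>) (Suc n))) =
      expectation (\<lambda>\<omega>. \<Sum>e\<in>UNIV. indicator {e} (edge n \<omega>) * h (T e (?run \<omega>)))"
    by (simp add: indicator_def)
  also have "\<dots> = (\<Sum>e\<in>UNIV. expectation (\<lambda>\<omega>. indicator {e} (edge n \<omega>)) * expectation (\<lambda>\<omega>. h (T e (?run \<omega>))))"
    using indep_var_lebesgue_integral[OF indep_e int_ind int_run]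
      indep_var_integrable[OF indep_e int_ind int_run]
    by (subst Bochner_Integration.integral_sum) simp_all
  also have "\<dots> = (\<Sum>e\<in>UNIV. prob {\<omega> \<in> space M. edge n \<omega> = e} * expectation (\<lambda>\<omega>. h (T e (?run \<omega>))))"
  proof (intro sum.cong refl arg_cong2[where f = times])
    fix e
    have "expectation (\<lambda>\<omega>. indicator {e} (edge n \<omega>)) =
        expectation (indicator {\<omega> \<in> space M. edge n \<omega> = e} :: 'a \<Rightarrow> real)"
      by (rule Bochner_Integration.integral_cong) (auto simp: indicator_def)
    then show "expectation (\<lambda>\<omega>. indicator {e} (edge n \<omega>)) = prob {\<omega> \<in> space M. edge n \<omega> = e}"
      by simp
  qed
  finally show ?thesis .
qed

lemma expectation_square_le:
  fixes Y :: "'a \<Rightarrow> real"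
  assumes "integrable M Y" "integrable M (\<lambda>\<omega>. (Y \<omega>)\<^sup>2)"
  shows "(expectation Y)\<^sup>2 \<le> expectation (\<lambda>\<omega>. (Y \<omega>)\<^sup>2)"
  using variance_positive[of Y] variance_eq[OF assms] by simp

end

section \<open>The convergence rate of the randomized method\<close>

theorem theorem3:
  fixes f :: "('b::finite, 'y::finite, 'z::finite) point \<Rightarrow> real"
    and gf :: "('b, 'y, 'z) point \<Rightarrow> ('b, 'y, 'z) point"
    and L :: real
    and E :: "'b set set"
    and p :: "'b set \<Rightarrow> real"
    and x0 :: "('b, 'y, 'z) point"
    and M :: "'w measure"
    and edge :: "nat \<Rightarrow> 'w \<Rightarrow> 'b set"
    and X :: "nat \<Rightarrow> 'w \<Rightarrow> ('b, 'y, 'z) point"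
    and k :: nat
  assumes "convex_on UNIV f"
    and "\<And>x. GDERIV f x :> gf x"
    and "continuous_on UNIV gf"
    and "optimal_set f \<noteq> {}"
    and "L > 0"
    and "block_lipschitz L gf"
    and "edge_lipschitz L E gf"
    and "connected_graph E"
    and "edge_probabilities E p"
    and "feasible x0"
    and "radius_exists f L p x0"
    and "prob_space M"
    and "prob_space.indep_vars M (\<lambda>_. count_space UNIV) edge UNIV"
    and "\<And>n \<omega>. \<omega> \<in> space M \<Longrightarrow> edge n \<omega> \<in> E"
    and "\<And>n e. e \<in> E \<Longrightarrow> prob_space.prob M {\<omega> \<in> space M. edge n \<omega> = e} = p e"
    and "\<And>\<omega>. \<omega> \<in> space M \<Longrightarrow> descent_run f gf L (\<lambda>_. 1) x0 (\<lambda>n. edge n \<omega>) (\<lambda>n. X n \<omega>)"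
    and "k \<ge> 1"
  shows "prob_space.expectation M (\<lambda>\<omega>. f (X k \<omega>)) - optimal_value f
           \<le> 2 * (radius f L p x0)\<^sup>2 / real k"
proof -
  interpret prob_space M by fact
  interpret pair_descent L E p f gf
    by unfold_locales fact+
  note indep = assms(13) and edge_in = assms(14) and edge_prob = assms(15)
  obtain xs where xs: "xs \<in> optimal_set f" using assms(4) by blast
  let ?R = "radius f L p x0"
  \<comment> \<open>\<open>X\<close> is tied to the edges only on \<open>space M\<close>;
    \<open>Y\<close> is a function of the edges everywhere, as the integrability and independence
    lemmas require.\<close>
  define Y where "Y n \<omega> = run step x0 (\<lambda>i. edge i \<omega>) n" for n \<omega>
  define D where "D n = expectation (\<lambda>\<omega>. f (Y n \<omega>)) - f xs" for n

  have X_eq: "X n \<omega> = Y n \<omega>" if "\<omega> \<in> space M" for n \<omega>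
  proof -
    have X: "X 0 \<omega> = x0" "X (Suc n) \<omega> = step (edge n \<omega>) (X n \<omega>)" for n
      using assms(16)[OF that] descent_step_imp_pair_step[OF L_pos] unfolding descent_run_def by blast+
    show ?thesis
      unfolding Y_def by (induction n) (simp_all add: X)
  qed
  \<comment> \<open>Feasibility serves \<open>gap_le\<close>, and the level bound serves
    \<open>dual_norm_le_radius\<close>.\<close>
  have Y_inv: "feasible (Y n \<omega>) \<and> f (Y n \<omega>) \<le> f x0" if "\<omega> \<in> space M" for n \<omega>
    unfolding Y_def
    by (induction n) (simp_all add: assms(10) edge_in[OF that] step_feasible step_le[THEN order_trans])
  have int: "integrable M (\<lambda>\<omega>. h (Y n \<omega>))" for h :: "_ \<Rightarrow> real" and n
    unfolding Y_def by (rule integrable_run[OF indep])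

  have step_expectation:
    "expectation (\<lambda>\<omega>. f (Y (Suc n) \<omega>)) = expectation (\<lambda>\<omega>. \<Sum>e\<in>E. p e * f (step e (Y n \<omega>)))" for n
  proof -
    have "expectation (\<lambda>\<omega>. f (Y (Suc n) \<omega>)) =
        (\<Sum>e\<in>UNIV. prob {\<omega> \<in> space M. edge n \<omega> = e} * expectation (\<lambda>\<omega>. f (step e (Y n \<omega>))))"
      unfolding Y_def by (rule expectation_run_Suc[OF indep])
    also have "\<dots> = (\<Sum>e\<in>E. p e * expectation (\<lambda>\<omega>. f (step e (Y n \<omega>))))"
    proof (rule sum.mono_neutral_cong_right)
      show "\<forall>e\<in>UNIV - E. prob {\<omega> \<in> space M. edge n \<omega> = e} * expectation (\<lambda>\<omega>. f (step e (Y n \<omega>))) = 0"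
      proof
        fix e assume "e \<in> UNIV - E"
        \<comment> \<open>\<open>edge n\<close> takes values in \<open>E\<close> only, so sets
          outside \<open>E\<close> contribute nothing.\<close>
        then have none: "{\<omega> \<in> space M. edge n \<omega> = e} = {}" using edge_in by auto
        show "prob {\<omega> \<in> space M. edge n \<omega> = e} * expectation (\<lambda>\<omega>. f (step e (Y n \<omega>))) = 0"
          unfolding none by simp
      qed
    qed (simp_all add: edge_prob)
    also have "\<dots> = expectation (\<lambda>\<omega>. \<Sum>e\<in>E. p e * f (step e (Y n \<omega>)))"
      using int[of "\<lambda>y. f (step _ y)"] by (simp add: Bochner_Integration.integral_sum)
    finally show ?thesis .
  qed

  \<comment> \<open>The recursion for a single outcome, with the average over the next edge in the
    role of a conditional expectation.\<close>
  have gap: "(f (Y n \<omega>) - f xs)\<^sup>2 \<le> 2 * ?R\<^sup>2 * (f (Y n \<omega>) - (\<Sum>e\<in>E. p e * f (step e (Y n \<omega>))))"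
    if "\<omega> \<in> space M" for n \<omega>
  proof -
    let ?x = "Y n \<omega>" and ?K = "kform (gf (Y n \<omega>)) (gf (Y n \<omega>))"
    have "dual_norm L p (?x - xs) \<le> ?R"
      using dual_norm_le_radius[OF assms(11) _ xs] Y_inv[OF that] by blast
    then have "(dual_norm L p (?x - xs))\<^sup>2 \<le> ?R\<^sup>2"
      using gap_le(2)[OF _ xs] Y_inv[OF that] by (intro power_mono) auto
    then have "(f ?x - f xs)\<^sup>2 \<le> ?K * ?R\<^sup>2"
      using gap_le(1)[OF _ xs] Y_inv[OF that] kform_nonneg by (meson mult_left_mono order_trans)
    also have "\<dots> \<le> (2 * (f ?x - (\<Sum>e\<in>E. p e * f (step e ?x)))) * ?R\<^sup>2"
      using expected_decrease[of ?x] by (intro mult_right_mono) auto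
    finally show ?thesis by (simp add: algebra_simps)
  qed

  have "real k * D k \<le> 2 * ?R\<^sup>2"
  proof (rule quadratic_recursion_bound)
    fix n
    have "f xs \<le> expectation (\<lambda>\<omega>. f (Y n \<omega>))"
      using gap_le(3)[OF _ xs] Y_inv by (intro integral_ge_const int AE_I2) auto
    then show "0 \<le> D n" by (simp add: D_def)
    have "(D n)\<^sup>2 = (expectation (\<lambda>\<omega>. f (Y n \<omega>) - f xs))\<^sup>2"
      using int[of f n] by (simp add: D_def prob_space)
    \<comment> \<open>Jensen's inequality passes from the mean of the squared gaps to the square of
      the mean gap.\<close>
    also have "\<dots> \<le> expectation (\<lambda>\<omega>. (f (Y n \<omega>) - f xs)\<^sup>2)"
      by (intro expectation_square_le int[of "\<lambda>y. f y - f xs"] int[of "\<lambda>y. (f y - f xs)\<^sup>2"])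
    also have "\<dots> \<le> expectation (\<lambda>\<omega>. 2 * ?R\<^sup>2 * (f (Y n \<omega>) - (\<Sum>e\<in>E. p e * f (step e (Y n \<omega>)))))"
      by (intro integral_mono int[of "\<lambda>y. (f y - f xs)\<^sup>2"]
          int[of "\<lambda>y. 2 * ?R\<^sup>2 * (f y - (\<Sum>e\<in>E. p e * f (step e y)))"] gap)
    also have "\<dots> = 2 * ?R\<^sup>2 * (D n - D (Suc n))"
      using int[of f n] int[of "\<lambda>y. \<Sum>e\<in>E. p e * f (step e y)" n]
      by (simp add: D_def step_expectation)
    finally show "(D n)\<^sup>2 \<le> 2 * ?R\<^sup>2 * (D n - D (Suc n))" .
  qed simp
  moreover have "expectation (\<lambda>\<omega>. f (X k \<omega>)) - optimal_value f = D k"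
    unfolding D_def optimal_value_eq[OF xs]
    by (simp add: X_eq cong: Bochner_Integration.integral_cong)
  ultimately show ?thesis
    using assms(17) by (simp add: field_simps)
qed

end
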